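(* Let $X$ be a non-negative absolutely continuous random variable with probability density function $f$, and let $X_1,X_2,\ldots$ be i.i.d. copies of $X$. Let $K$ be a kernel density function such that: (i) $K$ is uniformly continuous and of bounded variation; (ii) $K(x)\to 0$ as $|x|\to\infty$; (iii) $\int |x\log|x||^{1/2}\,|dK(x)|<\infty$. Suppose $f$ is uniformly continuous. If $h_n\to 0$ and $(nh_n)^{-1}\log n\to 0$ as $n\to\infty$, where $h_n>0$ is the bandwidth, then $$VJD\to VJ(X)\quad\text{almost surely as } n\to\infty.$$
   Context: The varextropy of a non-negative absolutely continuous random variable $X$ with density $f$ is $$VJ(X)=\mathrm{Var}\left[-\tfrac12 f(X)\right]=\tfrac14 E[f^2(X)]-J^2(X)=\tfrac14\left[\int_0^{\infty}f^3(x)\,dx-\left(\int_0^\infty f^2(x)\,dx\right)^2\right],\qquad J(X)=-\tfrac12\int_0^\infty f^2(x)\,dx .$$ A kernel density function is a probability density function $K$ on $\mathbb{R}$; the kernel density estimator of $f$ with kernel $K$ and bandwidth $h_n$ based on $X_1,\ldots,X_n$ is $$\hat f(x)=\frac1{nh_n}\sum_{i=1}^nK\left(\frac{x-X_i}{h_n}\right).$$ The estimator $VJD$ (depending on $n$) is $$VJD=\tfrac14\left[\int_{\mathbb{R}}\hat f^3(x)\,dx-\left(\int_{\mathbb{R}}\hat f^2(x)\,dx\right)^2\right].$$ *)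

theory Defs
  imports "HOL-Probability.Probability"
begin

definition kernel_density :: "(real \<Rightarrow> real) \<Rightarrow> bool" where
  "kernel_density K \<longleftrightarrow>
     (\<forall>x. 0 \<le> K x) \<and> integrable lborel K \<and> integral\<^sup>L lborel K = 1"

definition variation_sums :: "(real \<Rightarrow> real) \<Rightarrow> real set \<Rightarrow> real set" where
  "variation_sums K S =
     {(\<Sum>i<n. \<bar>K (t (Suc i)) - K (t i)\<bar>) | n t. mono (t :: nat \<Rightarrow> real) \<and> range t \<subseteq> S}"

definition bounded_variation_on :: "real set \<Rightarrow> (real \<Rightarrow> real) \<Rightarrow> bool" where
  "bounded_variation_on S K \<longleftrightarrow> bdd_above (variation_sums K S)"

definition total_variation_on :: "real set \<Rightarrow> (real \<Rightarrow> real) \<Rightarrow> real" where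
  "total_variation_on S K = Sup (variation_sums K S)"

text \<open>The measure \<open>|dK|\<close>: the Lebesgue--Stieltjes measure of the total variation function
  \<open>x \<mapsto> V(K; (-\<infinity>, x])\<close>. It is meaningful only for right-continuous \<open>K\<close> of bounded variation
  on the line, since \<open>interval_measure F\<close> needs a monotone right-continuous \<open>F\<close>.\<close>
definition abs_stieltjes_measure :: "(real \<Rightarrow> real) \<Rightarrow> real measure" where
  "abs_stieltjes_measure K = interval_measure (\<lambda>x. total_variation_on {..x} K)"

text \<open>\<open>f\<close> is meant to be a density of \<open>X\<close>.\<close>
definition varextropy :: "'a measure \<Rightarrow> ('a \<Rightarrow> real) \<Rightarrow> (real \<Rightarrow> real) \<Rightarrow> real" where
  "varextropy M X f = prob_space.variance M (\<lambda>\<omega>. - (1/2) * f (X \<omega>))"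

text \<open>The sample is \<open>X 1, \<dots>, X n\<close>; the value \<open>X 0\<close> is not used.\<close>
definition kernel_density_estimator ::
    "(real \<Rightarrow> real) \<Rightarrow> real \<Rightarrow> nat \<Rightarrow> (nat \<Rightarrow> real) \<Rightarrow> real \<Rightarrow> real" where
  "kernel_density_estimator K h n X x =
     1 / (real n * h) * (\<Sum>i = 1..n. K ((x - X i) / h))"

definition VJD :: "(real \<Rightarrow> real) \<Rightarrow> real \<Rightarrow> nat \<Rightarrow> (nat \<Rightarrow> real) \<Rightarrow> real" where
  "VJD K h n X =
     1/4 * ((\<integral>x. (kernel_density_estimator K h n X x) ^ 3 \<partial>lborel)
            - (\<integral>x. (kernel_density_estimator K h n X x) ^ 2 \<partial>lborel) ^ 2)"

lemma varextropy_eq: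
  fixes X :: "'a \<Rightarrow> real" and f :: "real \<Rightarrow> real"
  assumes "prob_space M"
    and X: "distributed M lborel X (\<lambda>x. ennreal (f x))" and f0: "\<And>x. 0 \<le> f x"
    and X0: "AE \<omega> in M. 0 \<le> X \<omega>"
    and i2: "integrable lborel (\<lambda>x. f x ^ 2)" and i3: "integrable lborel (\<lambda>x. f x ^ 3)"
  shows "varextropy M X f =
    1/4 * ((\<integral>x\<in>{0..}. f x ^ 3 \<partial>lborel) - (\<integral>x\<in>{0..}. f x ^ 2 \<partial>lborel) ^ 2)"
proof -
  interpret prob_space M by fact
  have "(\<lambda>x. ennreal (f x)) \<in> borel_measurable borel"
    using distributed_borel_measurable[OF X] by simp
  then have f[measurable]: "f \<in> borel_measurable borel"
    using f0 by (subst (asm) borel_measurable_ennreal_iff) auto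
  have "AE x in density lborel (\<lambda>x. ennreal (f x)). 0 \<le> x"
    using X0 distributed_measurable[OF X]
    unfolding distributed_distr_eq_density[OF X, symmetric] by (subst AE_distr_iff) auto
  then have "AE x in lborel. 0 < f x \<longrightarrow> 0 \<le> x"
    by (subst (asm) AE_density) auto
  then have ae: "AE x in lborel. indicator {0..} x * f x = f x"
    by eventually_elim (use f0 in \<open>force simp: indicator_def less_le\<close>)
  have s: "(\<integral>x\<in>{0..}. f x ^ Suc k \<partial>lborel) = (\<integral>x. f x ^ Suc k \<partial>lborel)" for k
    unfolding set_lebesgue_integral_def
  proof (intro integral_cong_AE)
    show "AE x in lborel. indicator {0..} x *\<^sub>R f x ^ Suc k = f x ^ Suc k"
      using ae by eventually_elim (simp add: mult.assoc[symmetric])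
  qed auto
  have E: "expectation (\<lambda>\<omega>. f (X \<omega>) ^ k) = (\<integral>x. f x ^ Suc k \<partial>lborel)" for k
    using distributed_integral[OF X, of "\<lambda>x. f x ^ k"] f0 by simp
  have I: "integrable M (\<lambda>\<omega>. f (X \<omega>) ^ k) \<longleftrightarrow> integrable lborel (\<lambda>x. f x ^ Suc k)" for k
    using distributed_integrable[OF X, of "\<lambda>x. f x ^ k"] f0 by simp
  have i: "integrable M (\<lambda>\<omega>. f (X \<omega>))" "integrable M (\<lambda>\<omega>. (f (X \<omega>))\<^sup>2)"
    using I[of 1] I[of 2] i2 i3 by (simp_all add: numeral_2_eq_2 numeral_3_eq_3)
  have "varextropy M X f = expectation (\<lambda>\<omega>. (- (1/2) * f (X \<omega>))\<^sup>2)
      - (expectation (\<lambda>\<omega>. - (1/2) * f (X \<omega>)))\<^sup>2"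
    unfolding varextropy_def using i by (intro variance_eq) (simp_all add: power_divide)
  also have "\<dots> = 1/4 * (expectation (\<lambda>\<omega>. f (X \<omega>) ^ 2) - (expectation (\<lambda>\<omega>. f (X \<omega>) ^ 1)) ^ 2)"
    by (simp add: power_divide field_simps)
  finally show ?thesis
    unfolding E using s[of 1] s[of 2] by (simp add: numeral_2_eq_2 numeral_3_eq_3)
qed

end

theory Submission
  imports Defs
begin

text \<open>Both integrals in \<open>VJD\<close> are continuous functionals of the estimator in the following sense:
if densities \<open>u\<^sub>n\<close> converge uniformly to a bounded density \<open>f\<close>, then \<open>\<integral>u\<^sub>n\<^sup>2 \<longrightarrow> \<integral>f\<^sup>2\<close> and
\<open>\<integral>u\<^sub>n\<^sup>3 \<longrightarrow> \<integral>f\<^sup>3\<close> (\<open>tendsto_integral_power_of_uniform_limit\<close>), because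
\<open>\<bar>u\<^sup>2 - f\<^sup>2\<bar> \<le> (sup \<bar>u - f\<bar>) (u + f)\<close> and \<open>u + f\<close> has total mass 2. A kernel estimator is a
density, so the theorem follows from almost sure uniform convergence of the estimator to \<open>f\<close>.
The mean of the estimator is the convolution of \<open>f\<close> with an approximate identity, so it converges to
\<open>f\<close> uniformly (\<open>uniform_limit_convolution_kernel\<close>); the work lies in the random fluctuation about
the mean.

Fix \<open>\<delta> > 0\<close> and cut the line, for each \<open>n\<close>, into the countably many cells
\<open>[\<delta>h\<^sub>n k, \<delta>h\<^sub>n (k + 1))\<close>. If the empirical and the true mass of every cell differ by at most
\<open>\<delta>\<^sup>2 h\<^sub>n\<close>, then the estimator differs from its mean by at most
\<open>\<delta> + (B \<delta> + \<delta>\<^sup>2) V\<close> simultaneously at all points, where \<open>B\<close> bounds \<open>f\<close> and \<open>V\<close> is the total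
variation of \<open>K\<close> (\<open>kernel_estimator_close_to_mean\<close>): replacing \<open>K\<close> by its minimum on each cell
costs the oscillation of \<open>K\<close> there, and oscillations over disjoint cells add up to at most \<open>V\<close>,
while the minima times the cell width add up to at most \<open>\<integral>K = 1\<close>. A single lattice serves all
evaluation points \<open>x\<close>, so no discretisation in \<open>x\<close> is involved.

The cells are infinitely many, and \<open>X\<close> may have no moments, so a union bound works only if the deviation
probability of a cell is proportional to the mass of the cell. Chernoff's method applied to
\<open>e\<^sup>y + e\<^sup>-\<^sup>y - 2\<close> instead of \<open>e\<^sup>y\<close> gives this factor, because that function vanishes at the origin
(\<open>count_deviation_prob_le\<close>). The masses sum to 1, and what remains is at most of order
\<open>n exp (- c n h\<^sub>n)\<close>, which is summable since \<open>n h\<^sub>n\<close> outgrows every multiple of \<open>log n\<close>. The Borel--Cantelli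
lemma concludes (\<open>AE_cell_counts_concentrate\<close>).\<close>

section \<open>Integrals and lattice cells\<close>

text \<open>The half-open cells of the lattice of mesh \<open>w\<close>. They are enumerated by natural numbers so that
countable sums over them are ordinary series.\<close>
definition cell :: "real \<Rightarrow> nat \<Rightarrow> real set" where
  "cell w i = {w * int_decode i ..< w * (int_decode i + 1)}"

lemma cell_sets [measurable]: "cell w i \<in> sets borel"
  by (simp add: cell_def)

lemma mem_cell_iff:
  assumes "0 < w"
  shows "x \<in> cell w i \<longleftrightarrow> int_decode i = \<lfloor>x / w\<rfloor>"
  using assms by (auto simp: cell_def floor_eq_iff field_simps eq_commute[of _ "\<lfloor>_\<rfloor>"])

lemma disjoint_family_cell: "0 < w \<Longrightarrow> disjoint_family (cell w)"
  by (auto simp: disjoint_family_on_def mem_cell_iff) (metis int_decode_inverse)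

lemma UN_cell: "0 < w \<Longrightarrow> (\<Union>i. cell w i) = UNIV"
  by (auto simp: mem_cell_iff) (metis int_encode_inverse)

lemma nn_integral_cells:
  assumes w: "0 < w" and sets: "sets \<nu> = sets borel" and g: "g \<in> borel_measurable borel"
  shows "(\<integral>\<^sup>+x. g x \<partial>\<nu>) = (\<Sum>i. \<integral>\<^sup>+x\<in>cell w i. g x \<partial>\<nu>)"
proof -
  have [measurable]: "g \<in> borel_measurable \<nu>"
    using g sets measurable_cong_sets by blast
  have [measurable]: "cell w i \<in> sets \<nu>" for i
    using sets by simp
  have "(\<Sum>i. g x * indicator (cell w i) x) = g x" for x
    using UN_cell[OF w] by (intro suminf_cmult_indicator[OF disjoint_family_cell[OF w], of x "int_encode \<lfloor>x / w\<rfloor>"])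
      (auto simp: mem_cell_iff[OF w])
  then show ?thesis
    by (subst nn_integral_suminf[symmetric]) auto
qed

text \<open>Ordering the two chosen points inside each of the consecutive cells produces one increasing
sequence; the oscillations are the increments at its even positions.\<close>
lemma sum_cell_oscillation_le:
  fixes g :: "real \<Rightarrow> real" and s t :: "int \<Rightarrow> real" and w :: real
  assumes V: "\<And>v. v \<in> variation_sums g UNIV \<Longrightarrow> v \<le> V" and w: "0 < w"
    and s: "\<And>k::int. s k \<in> {w * k .. w * (k + 1)}"
    and t: "\<And>k::int. t k \<in> {w * k .. w * (k + 1)}"
    and F: "finite F"
  shows "(\<Sum>k\<in>F. \<bar>g (s k) - g (t k)\<bar>) \<le> V"
proof -
  obtain N where N: "F \<subseteq> {- int N ..< int N}"
  proof
    show "F \<subseteq> {- int (nat (\<Sum>k\<in>F. \<bar>k\<bar>) + 1) ..< int (nat (\<Sum>k\<in>F. \<bar>k\<bar>) + 1)}"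
    proof
      fix k assume "k \<in> F"
      then have "\<bar>k\<bar> \<le> (\<Sum>k\<in>F. \<bar>k\<bar>)"
        using F by (intro member_le_sum) auto
      then show "k \<in> {- int (nat (\<Sum>k\<in>F. \<bar>k\<bar>) + 1) ..< int (nat (\<Sum>k\<in>F. \<bar>k\<bar>) + 1)}"
        by auto
    qed
  qed
  \<comment> \<open>Two points per cell, from the cell of index \<open>-N\<close> upwards: the lower at \<open>2 i\<close>, the upper at \<open>2 i + 1\<close>.\<close>
  define p where "p j = int (j div 2) - int N" for j
  define q where "q j = (if even j then min (s (p j)) (t (p j)) else max (s (p j)) (t (p j)))" for j
  have "q j \<le> q (Suc j)" for j
  proof (cases "even j")
    case True
    then have "p (Suc j) = p j" by (simp add: p_def)
    then show ?thesis using True by (simp add: q_def)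
  next
    case False
    then have p: "p (Suc j) = p j + 1" by (auto simp: p_def elim!: oddE)
    have "q j \<le> w * (p j + 1)"
      using s[of "p j"] t[of "p j"] False by (auto simp: q_def)
    also have "\<dots> \<le> q (Suc j)"
      using s[of "p j + 1"] t[of "p j + 1"] False by (auto simp: q_def p)
    finally show ?thesis .
  qed
  then have q: "mono q" by (simp add: mono_iff_le_Suc)
  have "(\<Sum>k\<in>F. \<bar>g (s k) - g (t k)\<bar>) \<le> (\<Sum>k=-int N..<int N. \<bar>g (s k) - g (t k)\<bar>)"
    using N by (intro sum_mono2) auto
  also have "\<dots> = (\<Sum>i<2*N. \<bar>g (s (int i - int N)) - g (t (int i - int N))\<bar>)"
    by (rule sum.reindex_bij_witness[of _ "\<lambda>i. int i - int N" "\<lambda>k. nat (k + int N)"]) auto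
  also have "\<dots> = (\<Sum>i<2*N. \<bar>g (q (Suc (2*i))) - g (q (2*i))\<bar>)"
    by (intro sum.cong refl) (auto simp: q_def p_def min_def max_def)
  also have "\<dots> = (\<Sum>j\<in>(\<lambda>i. 2*i) ` {..<2*N}. \<bar>g (q (Suc j)) - g (q j)\<bar>)"
    by (subst sum.reindex) (auto simp: inj_on_def)
  also have "\<dots> \<le> (\<Sum>j<4*N. \<bar>g (q (Suc j)) - g (q j)\<bar>)"
    by (intro sum_mono2) auto
  also have "\<dots> \<le> V"
    using q by (intro V) (auto simp: variation_sums_def)
  finally show ?thesis .
qed

text \<open>On a cell with minimum \<open>m\<close> and maximum \<open>M\<close> of \<open>g\<close>, the integral with respect to \<open>\<nu>\<close> is at most
\<open>M \<nu>(cell) = m \<nu>(cell) + (M - m) \<nu>(cell) \<le> m (\<mu>(cell) + e) + (M - m) b\<close>. The term \<open>m \<mu>(cell)\<close> is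
below the integral with respect to \<open>\<mu>\<close>, the term \<open>m e\<close> is \<open>e / w\<close> times a lower Lebesgue sum, and the
numbers \<open>M - m\<close> sum to at most the variation \<open>V\<close>. The estimate is one-sided, so exchanging the two
measures yields the bound on the difference.\<close>
lemma nn_integral_le_if_cell_masses_le:
  fixes g :: "real \<Rightarrow> real"
  assumes w: "0 < w" and g: "continuous_on UNIV g" "\<And>x. 0 \<le> g x"
    and V: "\<And>v. v \<in> variation_sums g UNIV \<Longrightarrow> v \<le> V"
    and sets: "sets \<mu> = sets borel" "sets \<nu> = sets borel"
    and e: "0 \<le> e" "\<And>i. emeasure \<nu> (cell w i) \<le> emeasure \<mu> (cell w i) + ennreal e"
    and b: "0 \<le> b" "\<And>i. emeasure \<nu> (cell w i) \<le> ennreal b"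
  shows "(\<integral>\<^sup>+x. g x \<partial>\<nu>) \<le>
    (\<integral>\<^sup>+x. g x \<partial>\<mu>) + ennreal (e / w) * (\<integral>\<^sup>+x. g x \<partial>lborel) + ennreal (b * V)"
proof -
  have gm: "(\<lambda>x. ennreal (g x)) \<in> borel_measurable borel"
    using borel_measurable_continuous_onI[OF g(1)] by measurable
  note [measurable_cong] = sets
  note [measurable] = gm
  have "\<exists>s\<in>{w * k .. w * (k + 1)}. \<forall>x\<in>{w * k .. w * (k + 1)}. g x \<le> g s" for k :: int
    using w by (intro continuous_attains_sup) (auto intro: continuous_on_subset[OF g(1)])
  then obtain s :: "int \<Rightarrow> real" where s: "\<And>k::int. s k \<in> {w * k .. w * (k + 1)}"
    "\<And>(k::int) x. x \<in> {w * k .. w * (k + 1)} \<Longrightarrow> g x \<le> g (s k)"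
    by metis
  have "\<exists>s\<in>{w * k .. w * (k + 1)}. \<forall>x\<in>{w * k .. w * (k + 1)}. g s \<le> g x" for k :: int
    using w by (intro continuous_attains_inf) (auto intro: continuous_on_subset[OF g(1)])
  then obtain t :: "int \<Rightarrow> real" where t: "\<And>k::int. t k \<in> {w * k .. w * (k + 1)}"
    "\<And>(k::int) x. x \<in> {w * k .. w * (k + 1)} \<Longrightarrow> g (t k) \<le> g x"
    by metis
  define M where "M i = g (s (int_decode i))" for i
  define m where "m i = g (t (int_decode i))" for i
  have M: "x \<in> cell w i \<Longrightarrow> g x \<le> M i" and m: "x \<in> cell w i \<Longrightarrow> m i \<le> g x" for x i
    using s(2)[of x "int_decode i"] t(2)[of x "int_decode i"] by (auto simp: M_def m_def cell_def)
  have m0: "0 \<le> m i" and mM: "m i \<le> M i" for i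
    using g(2) s(2)[OF t(1), of "int_decode i"] by (auto simp: m_def M_def)
  have low: "ennreal (m i) * emeasure \<rho> (cell w i) \<le> (\<integral>\<^sup>+x\<in>cell w i. g x \<partial>\<rho>)"
    if [measurable_cong]: "sets \<rho> = sets borel" for \<rho> i
  proof -
    have "ennreal (m i) * emeasure \<rho> (cell w i) = (\<integral>\<^sup>+x\<in>cell w i. ennreal (m i) \<partial>\<rho>)"
      by (simp add: nn_integral_cmult_indicator that)
    also have "\<dots> \<le> (\<integral>\<^sup>+x\<in>cell w i. g x \<partial>\<rho>)"
      by (intro nn_integral_mono) (auto simp: indicator_def m ennreal_leI)
    finally show ?thesis .
  qed
  have lb: "emeasure lborel (cell w i) = ennreal w" for i
    using w by (simp add: cell_def algebra_simps)
  have cell_le: "(\<integral>\<^sup>+x\<in>cell w i. g x \<partial>\<nu>) \<le> (\<integral>\<^sup>+x\<in>cell w i. g x \<partial>\<mu>)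
      + ennreal (e / w) * (\<integral>\<^sup>+x\<in>cell w i. g x \<partial>lborel) + ennreal b * ennreal (M i - m i)" for i
  proof -
    have "(\<integral>\<^sup>+x\<in>cell w i. g x \<partial>\<nu>) \<le> (\<integral>\<^sup>+x\<in>cell w i. ennreal (M i) \<partial>\<nu>)"
      by (intro nn_integral_mono) (auto simp: indicator_def M ennreal_leI)
    also have "\<dots> = ennreal (m i + (M i - m i)) * emeasure \<nu> (cell w i)"
      by (simp add: nn_integral_cmult_indicator sets)
    also have "\<dots> = ennreal (m i) * emeasure \<nu> (cell w i) + ennreal (M i - m i) * emeasure \<nu> (cell w i)"
      using m0 mM by (subst ennreal_plus) (auto simp: algebra_simps)
    also have "\<dots> \<le> ennreal (m i) * (emeasure \<mu> (cell w i) + ennreal e) + ennreal (M i - m i) * ennreal b"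
      by (intro add_mono mult_left_mono e b) auto
    also have "ennreal (m i) * (emeasure \<mu> (cell w i) + ennreal e) =
        ennreal (m i) * emeasure \<mu> (cell w i) + ennreal (e / w) * (ennreal (m i) * emeasure lborel (cell w i))"
      using w e(1) m0[of i] unfolding lb
      by (simp add: algebra_simps ennreal_mult[symmetric])
    also have "\<dots> \<le> (\<integral>\<^sup>+x\<in>cell w i. g x \<partial>\<mu>) + ennreal (e / w) * (\<integral>\<^sup>+x\<in>cell w i. g x \<partial>lborel)"
      by (intro add_mono mult_left_mono low) (auto simp: sets)
    finally show ?thesis by (simp add: mult.commute add_mono)
  qed
  have osc: "(\<Sum>i. ennreal (M i - m i)) \<le> ennreal V"
  proof (rule suminf_le_const)
    fix n
    have "(\<Sum>i<n. M i - m i) = (\<Sum>i<n. \<bar>M i - m i\<bar>)"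
      using mM by (intro sum.cong) auto
    also have "\<dots> = (\<Sum>k\<in>int_decode ` {..<n}. \<bar>g (s k) - g (t k)\<bar>)"
      by (simp add: sum.reindex[OF inj_int_decode] M_def m_def)
    also have "\<dots> \<le> V"
      by (rule sum_cell_oscillation_le[OF V w s(1) t(1)]) auto
    finally show "(\<Sum>i<n. ennreal (M i - m i)) \<le> ennreal V"
      using mM by (simp add: sum_ennreal ennreal_leI)
  qed auto
  have "(\<integral>\<^sup>+x. g x \<partial>\<nu>) = (\<Sum>i. \<integral>\<^sup>+x\<in>cell w i. g x \<partial>\<nu>)"
    by (rule nn_integral_cells[OF w sets(2) gm])
  also have "\<dots> \<le> (\<Sum>i. (\<integral>\<^sup>+x\<in>cell w i. g x \<partial>\<mu>)
      + ennreal (e / w) * (\<integral>\<^sup>+x\<in>cell w i. g x \<partial>lborel) + ennreal b * ennreal (M i - m i))"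
    by (intro suminf_le cell_le) auto
  also have "\<dots> = (\<integral>\<^sup>+x. g x \<partial>\<mu>) + ennreal (e / w) * (\<integral>\<^sup>+x. g x \<partial>lborel)
      + ennreal b * (\<Sum>i. ennreal (M i - m i))"
    unfolding nn_integral_cells[OF w sets(1) gm] nn_integral_cells[OF w sets_lborel gm]
      ennreal_suminf_cmult[symmetric]
    by (simp only: suminf_add summableI)
  also have "\<dots> \<le> (\<integral>\<^sup>+x. g x \<partial>\<mu>) + ennreal (e / w) * (\<integral>\<^sup>+x. g x \<partial>lborel) + ennreal (b * V)"
    using b(1) osc by (auto simp: ennreal_mult' intro!: add_mono mult_left_mono)
  finally show ?thesis .
qed

section \<open>Concentration of cell counts\<close>

lemma exp_le_quadratic:
  fixes x :: real
  assumes "\<bar>x\<bar> \<le> 1"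
  shows "exp x \<le> 1 + x + x\<^sup>2"
proof (cases "0 \<le> x")
  case True
  then show ?thesis using exp_bound[of x] assms by simp
next
  case False
  define y where "y = - x"
  have y: "0 < y" "y \<le> 1" using False assms by (auto simp: y_def)
  have "1 \<le> 1 + y ^ 3" using y by simp
  also have "1 + y ^ 3 = (1 + y) * (1 - y + y\<^sup>2)" by (simp add: power2_eq_square power3_eq_cube algebra_simps)
  also have "\<dots> \<le> exp y * (1 - y + y\<^sup>2)"
    using y by (intro mult_right_mono exp_ge_add_one_self) (auto intro: add_nonneg_nonneg)
  finally have "exp (- y) \<le> 1 - y + y\<^sup>2"
    by (simp add: exp_minus field_simps)
  then show ?thesis by (simp add: y_def)
qed

context prob_space
begin

text \<open>The exponential moment factorises over the independent indicators. The exponent in the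
bound is linear in \<open>p\<close>; this linearity becomes the factor \<open>p\<close> of the deviation bound below.\<close>
lemma centred_count_exp_moment:
  fixes Y :: "'i \<Rightarrow> 'a \<Rightarrow> real"
  assumes I: "finite I" and ind: "indep_vars (\<lambda>_. borel) Y I"
    and A [measurable]: "A \<in> sets borel" and p: "\<And>i. i \<in> I \<Longrightarrow> prob (Y i -` A \<inter> space M) = p"
    and l: "\<bar>l\<bar> \<le> 1"
  defines "D \<equiv> \<lambda>\<omega>. (\<Sum>i\<in>I. indicator A (Y i \<omega>)) - real (card I) * p"
  shows "integrable M (\<lambda>\<omega>. exp (l * D \<omega>))"
    and "expectation (\<lambda>\<omega>. exp (l * D \<omega>)) \<le> exp (real (card I) * p * l\<^sup>2)"
proof -
  have rv: "random_variable borel (Y i)" if "i \<in> I" for i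
    using ind that by (auto simp: indep_vars_def)
  define Z where "Z i \<omega> = exp (l * (indicator A (Y i \<omega>) - p))" for i \<omega>
  have prod: "(\<lambda>\<omega>. exp (l * D \<omega>)) = (\<lambda>\<omega>. \<Prod>i\<in>I. Z i \<omega>)"
    using I by (auto simp: D_def Z_def exp_sum[symmetric] sum_subtractf sum_distrib_left[symmetric])
  have indZ: "indep_vars (\<lambda>_. borel) Z I"
    unfolding Z_def by (rule indep_vars_compose2[OF ind]) measurable
  have Z: "integrable M (Z i)" "expectation (Z i) \<le> exp (p * l\<^sup>2)" if i: "i \<in> I" for i
  proof -
    note [measurable] = rv[OF i]
    have Z': "Z i = (\<lambda>\<omega>. exp (- l * p) * (1 + (exp l - 1) * indicator A (Y i \<omega>)))"
      by (auto simp: Z_def indicator_def algebra_simps exp_diff exp_minus field_simps)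
    have ind_eq: "(\<lambda>\<omega>. indicator A (Y i \<omega>) :: real) = indicator (Y i -` A)"
      by (auto simp: indicator_def)
    have int: "integrable M (\<lambda>\<omega>. indicator A (Y i \<omega>) :: real)"
      by (rule integrable_const_bound[of _ 1]) auto
    have ex: "expectation (\<lambda>\<omega>. indicator A (Y i \<omega>) :: real) = p"
      using p[OF i] unfolding ind_eq by (simp add: Int_commute)
    show "integrable M (Z i)" unfolding Z' using int by auto
    have "expectation (Z i) = exp (- l * p) * (1 + (exp l - 1) * p)"
      unfolding Z' using int ex by (simp add: prob_space)
    also have "\<dots> \<le> exp (- l * p) * exp ((exp l - 1) * p)"
      by (intro mult_left_mono exp_ge_add_one_self) auto
    also have "\<dots> = exp (p * (exp l - 1 - l))"
      by (simp add: exp_add[symmetric] algebra_simps)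
    also have "\<dots> \<le> exp (p * l\<^sup>2)"
      using exp_le_quadratic[OF l] p[OF i] by (auto intro!: mult_left_mono)
    finally show "expectation (Z i) \<le> exp (p * l\<^sup>2)" .
  qed
  show "integrable M (\<lambda>\<omega>. exp (l * D \<omega>))"
    unfolding prod by (rule indep_vars_integrable[OF I indZ Z(1)])
  have "expectation (\<lambda>\<omega>. exp (l * D \<omega>)) = (\<Prod>i\<in>I. expectation (Z i))"
    unfolding prod by (rule indep_vars_lebesgue_integral[OF I indZ Z(1)])
  also have "\<dots> \<le> (\<Prod>i\<in>I. exp (p * l\<^sup>2))"
    by (intro prod_mono conjI Z(2)) (auto simp: Z_def)
  also have "\<dots> = exp (real (card I) * p * l\<^sup>2)"
    by (simp add: exp_of_nat_mult[symmetric] mult.assoc)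
  finally show "expectation (\<lambda>\<omega>. exp (l * D \<omega>)) \<le> exp (real (card I) * p * l\<^sup>2)" .
qed

text \<open>A Chernoff bound that is proportional to \<open>p\<close>. Markov's inequality is applied to
\<open>\<psi> = exp (l D) + exp (- l D) - 2\<close>, which is nonnegative, controls both tails, and has expectation at
most \<open>2 (exp x - 1) \<le> 2 x exp x\<close> for \<open>x = N p l\<^sup>2\<close>. The usual choice \<open>exp (l D)\<close> has expectation
close to 1 however small \<open>p\<close> is, and its bounds could not be added over infinitely many cells.\<close>
lemma count_deviation_prob_le:
  fixes Y :: "'i \<Rightarrow> 'a \<Rightarrow> real"
  assumes I: "finite I" and ind: "indep_vars (\<lambda>_. borel) Y I"
    and A [measurable]: "A \<in> sets borel" and p: "\<And>i. i \<in> I \<Longrightarrow> prob (Y i -` A \<inter> space M) = p"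
    and p0: "0 \<le> p" and l: "0 \<le> l" "l \<le> 1" and s: "2 < exp (l * s)"
  defines "D \<equiv> \<lambda>\<omega>. (\<Sum>i\<in>I. indicator A (Y i \<omega>)) - real (card I) * p"
  shows "prob {\<omega> \<in> space M. s \<le> \<bar>D \<omega>\<bar>} \<le>
    p * (2 * real (card I) * exp (real (card I) * p * l\<^sup>2) / (exp (l * s) - 2))"
proof -
  define N where "N = real (card I)"
  define x where "x = N * p * l\<^sup>2"
  have l': "\<bar>l\<bar> \<le> 1" "\<bar>- l\<bar> \<le> 1" using l by auto
  have m1: "integrable M (\<lambda>\<omega>. exp (l * D \<omega>))" "expectation (\<lambda>\<omega>. exp (l * D \<omega>)) \<le> exp x"
    unfolding D_def x_def N_def
    by (rule centred_count_exp_moment[OF I ind A]; simp only: p l')+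
  have m2: "integrable M (\<lambda>\<omega>. exp (- l * D \<omega>))" "expectation (\<lambda>\<omega>. exp (- l * D \<omega>)) \<le> exp x"
    unfolding D_def x_def N_def power2_minus[of l, symmetric]
    by (rule centred_count_exp_moment[OF I ind A]; simp only: p l')+
  define \<psi> where "\<psi> \<omega> = exp (l * D \<omega>) + exp (- l * D \<omega>) - 2" for \<omega>
  have amgm: "2 \<le> exp y + exp (- y)" for y :: real
    using cosh_real_ge_1[of y] by (simp add: cosh_def)
  have int: "integrable M \<psi>"
    unfolding \<psi>_def using m1(1) m2(1)
    by (intro Bochner_Integration.integrable_add Bochner_Integration.integrable_diff) auto
  have "expectation \<psi> = expectation (\<lambda>\<omega>. exp (l * D \<omega>)) + expectation (\<lambda>\<omega>. exp (- l * D \<omega>)) - 2"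
    unfolding \<psi>_def using m1(1) m2(1) by (simp add: prob_space)
  then have "expectation \<psi> \<le> 2 * (exp x - 1)"
    using m1(2) m2(2) by simp
  also have "exp x - 1 \<le> x * exp x"
  proof -
    have "(1 - x) * exp x \<le> exp (- x) * exp x"
      using exp_ge_add_one_self[of "- x"] by (intro mult_right_mono) auto
    then show ?thesis by (simp add: exp_minus algebra_simps)
  qed
  also have "x * exp x \<le> N * p * exp x"
    using l p0 by (intro mult_right_mono) (auto simp: x_def N_def power_le_one intro!: mult_left_le)
  finally have E: "expectation \<psi> \<le> 2 * (N * p * exp x)" by simp
  have "prob {\<omega> \<in> space M. s \<le> \<bar>D \<omega>\<bar>} \<le> prob {\<omega> \<in> space M. exp (l * s) - 2 \<le> \<psi> \<omega>}"
  proof (intro finite_measure_mono)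
    show "{\<omega> \<in> space M. exp (l * s) - 2 \<le> \<psi> \<omega>} \<in> events"
      using borel_measurable_integrable[OF int] by measurable
    show "{\<omega> \<in> space M. s \<le> \<bar>D \<omega>\<bar>} \<subseteq> {\<omega> \<in> space M. exp (l * s) - 2 \<le> \<psi> \<omega>}"
    proof safe
      fix \<omega> assume "s \<le> \<bar>D \<omega>\<bar>"
      then have "exp (l * s) \<le> exp (l * \<bar>D \<omega>\<bar>)"
        using l by (auto intro!: mult_left_mono)
      also have "\<dots> \<le> exp (l * D \<omega>) + exp (- l * D \<omega>)"
        by (cases "0 \<le> D \<omega>") auto
      finally show "exp (l * s) - 2 \<le> \<psi> \<omega>" by (simp add: \<psi>_def)
    qed
  qed
  also have "\<dots> \<le> expectation \<psi> / (exp (l * s) - 2)"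
    using s amgm by (intro integral_Markov_inequality_measure[OF int, of "{}"]) (simp_all add: \<psi>_def)
  also have "\<dots> \<le> 2 * (N * p * exp x) / (exp (l * s) - 2)"
    using s E by (intro divide_right_mono) auto
  finally show ?thesis by (simp add: x_def N_def mult_ac)
qed

text \<open>The bounds for the cells add up because each carries the mass of its cell as a factor and the
masses sum to 1.\<close>
lemma some_cell_deviation_prob_le:
  fixes Y :: "'i \<Rightarrow> 'a \<Rightarrow> real"
  assumes I: "finite I" and ind: "indep_vars (\<lambda>_. borel) Y I"
    and \<mu>: "prob_space \<mu>" "\<And>i. i \<in> I \<Longrightarrow> distr M borel (Y i) = \<mu>" "sets \<mu> = sets borel"
    and w: "0 < w" and b: "\<And>k. measure \<mu> (cell w k) \<le> b"
    and l: "0 \<le> l" "l \<le> 1" and s: "2 < exp (l * s)"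
  shows "prob {\<omega> \<in> space M. \<exists>k. s \<le>
      \<bar>(\<Sum>i\<in>I. indicator (cell w k) (Y i \<omega>)) - real (card I) * measure \<mu> (cell w k)\<bar>}
    \<le> 2 * real (card I) * exp (real (card I) * b * l\<^sup>2) / (exp (l * s) - 2)"
    (is "prob {\<omega> \<in> space M. \<exists>k. ?P k \<omega>} \<le> ?C")
proof -
  interpret mu: prob_space \<mu> by fact
  have rv: "random_variable borel (Y i)" if "i \<in> I" for i
    using ind that by (auto simp: indep_vars_def)
  have [measurable]: "(\<lambda>\<omega>. \<Sum>i\<in>I. indicator (cell w k) (Y i \<omega>) :: real) \<in> borel_measurable M" for k
    using rv by (intro borel_measurable_sum) (auto intro: measurable_compose)
  have p: "prob (Y i -` cell w k \<inter> space M) = measure \<mu> (cell w k)" if "i \<in> I" for i k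
    using rv[OF that] unfolding \<mu>(2)[OF that, symmetric] by (simp add: measure_distr)
  have "(\<Sum>k. emeasure \<mu> (cell w k)) = emeasure \<mu> (\<Union>k. cell w k)"
    using cell_sets[of w] unfolding \<mu>(3)[symmetric]
    by (intro suminf_emeasure disjoint_family_cell[OF w] image_subsetI)
  also have "\<dots> = 1"
    unfolding UN_cell[OF w] using mu.emeasure_space_1 sets_eq_imp_space_eq[OF \<mu>(3)] by simp
  finally have total: "(\<Sum>k. emeasure \<mu> (cell w k)) = 1" .
  have C0: "0 \<le> ?C" using s by simp
  have each: "prob {\<omega> \<in> space M. ?P k \<omega>} \<le> measure \<mu> (cell w k) * ?C" for k
  proof -
    have "prob {\<omega> \<in> space M. ?P k \<omega>} \<le> measure \<mu> (cell w k) *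
      (2 * real (card I) * exp (real (card I) * measure \<mu> (cell w k) * l\<^sup>2) / (exp (l * s) - 2))"
      by (rule count_deviation_prob_le[OF I ind cell_sets _ measure_nonneg l s]) (rule p)
    also have "\<dots> \<le> measure \<mu> (cell w k) * ?C"
      using b[of k] s
      by (intro mult_left_mono[OF _ measure_nonneg] divide_right_mono mult_left_mono[of _ _ "2 * real (card I)"])
        (simp_all add: mult_left_mono mult_right_mono)
    finally show ?thesis .
  qed
  have "emeasure M {\<omega> \<in> space M. \<exists>k. ?P k \<omega>} = emeasure M (\<Union>k. {\<omega> \<in> space M. ?P k \<omega>})"
    by (intro arg_cong[of _ _ "emeasure M"]) auto
  also have "\<dots> \<le> (\<Sum>k. emeasure M {\<omega> \<in> space M. ?P k \<omega>})"
    by (intro emeasure_subadditive_countably) auto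
  also have "\<dots> \<le> (\<Sum>k. emeasure \<mu> (cell w k) * ennreal ?C)"
    using each C0
    by (intro suminf_le) (auto simp: emeasure_eq_measure mu.emeasure_eq_measure ennreal_mult[symmetric] ennreal_leI)
  also have "\<dots> = (\<Sum>k. emeasure \<mu> (cell w k)) * ennreal ?C"
    by (rule ennreal_suminf_multc)
  also have "(\<Sum>k. emeasure \<mu> (cell w k)) = 1"
    unfolding total ..
  finally have "emeasure M {\<omega> \<in> space M. \<exists>k. ?P k \<omega>} \<le> ennreal ?C"
    unfolding mult_1 .
  then show ?thesis
    unfolding emeasure_eq_measure using C0 by (subst (asm) ennreal_le_iff)
qed

text \<open>Borel--Cantelli for the previous bound with deviation \<open>n e h\<^sub>n\<close>. It reads
\<open>2 n exp (n h\<^sub>n b l\<^sup>2) / (exp (l e n h\<^sub>n) - 2)\<close>, and \<open>l\<close> is taken so small that the exponential in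
the numerator is at most the square root of the one in the denominator.\<close>
lemma AE_cell_counts_concentrate:
  fixes Xs :: "nat \<Rightarrow> 'a \<Rightarrow> real" and h :: "nat \<Rightarrow> real"
  assumes ind: "indep_vars (\<lambda>_. borel) Xs {1..}"
    and \<mu>: "prob_space \<mu>" "\<And>i. 1 \<le> i \<Longrightarrow> distr M borel (Xs i) = \<mu>" "sets \<mu> = sets borel"
    and d: "0 < d" and h: "\<And>n. 1 \<le> n \<Longrightarrow> 0 < h n"
    and b: "0 < b" "\<And>n k. 1 \<le> n \<Longrightarrow> measure \<mu> (cell (d * h n) k) \<le> b * h n"
    and lim: "(\<lambda>n. inverse (real n * h n) * ln (real n)) \<longlonglongrightarrow> 0"
    and e: "0 < e"
  shows "AE \<omega> in M. \<forall>\<^sub>F n in sequentially. \<forall>k.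
    \<bar>(\<Sum>i=1..n. indicator (cell (d * h n) k) (Xs i \<omega>)) - real n * measure \<mu> (cell (d * h n) k)\<bar>
      < real n * (e * h n)"
proof -
  define P where "P n k \<omega> \<longleftrightarrow> real n * (e * h n) \<le>
    \<bar>(\<Sum>i=1..n. indicator (cell (d * h n) k) (Xs i \<omega>)) - real n * measure \<mu> (cell (d * h n) k)\<bar>" for n k \<omega>
  define A where "A n = {\<omega> \<in> space M. \<exists>k. P n k \<omega>}" for n
  define l where "l = min 1 (e / (2 * b))"
  have l: "0 < l" "l \<le> 1" and lb: "l * b \<le> e / 2"
    using e b(1) by (auto simp: l_def min_def field_simps)
  define c where "c = l * e"
  have c: "0 < c" using l e by (simp add: c_def)
  have rv: "random_variable borel (Xs i)" if "1 \<le> i" for i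
    using ind that by (auto simp: indep_vars_def)
  have [measurable]: "(\<lambda>\<omega>. \<Sum>i=1..n. indicator (cell (d * h n) k) (Xs i \<omega>) :: real) \<in> borel_measurable M" for n k
    using rv by (intro borel_measurable_sum) (auto intro: measurable_compose)
  have A: "A n \<in> sets M" for n
    unfolding A_def P_def by measurable
  \<comment> \<open>With \<open>8 ln n < c n h\<^sub>n\<close> the bound is below \<open>4 n exp (- c n h\<^sub>n / 2) \<le> 4 n\<^sup>-\<^sup>3\<close>.\<close>
  have "\<forall>\<^sub>F n in sequentially. inverse (real n * h n) * ln (real n) < c / 8"
    using c by (intro order_tendstoD[OF lim]) auto
  then have "\<forall>\<^sub>F n in sequentially. prob (A n) \<le> 4 * inverse (real n ^ 2)"
    using eventually_ge_at_top[of 2]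
  proof eventually_elim
    case (elim n)
    define y where "y = real n * h n"
    have y: "0 < y" using elim h[of n] by (simp add: y_def)
    have ln: "8 * ln (real n) < c * y"
      using elim(1) y by (simp add: y_def[symmetric] field_simps)
    have n4: "real n ^ 4 \<le> exp (c * y / 2)"
    proof -
      have "real n ^ 4 = exp (4 * ln (real n))"
        using elim(2) by (simp add: exp_of_nat_mult[of 4, simplified])
      then show ?thesis using ln by simp
    qed
    have "2 ^ 4 \<le> real n ^ 4" using elim(2) by (intro power_mono) auto
    then have z16: "16 \<le> exp (c * y / 2)" using n4 by simp
    define z where "z = exp (c * y / 2)"
    have z: "16 \<le> z" "real n ^ 4 \<le> z" using z16 n4 by (auto simp: z_def)
    have zz: "exp (c * y) = z * z" by (simp add: z_def exp_add[symmetric])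
    have "16 * 1 \<le> z * z" using z by (intro mult_mono) auto
    then have zz4: "4 \<le> z * z" by simp
    have "prob (A n) \<le> 2 * real (card {1..n}) * exp (real (card {1..n}) * (b * h n) * l\<^sup>2) /
        (exp (l * (real n * (e * h n))) - 2)"
      using some_cell_deviation_prob_le[of "{1..n}" Xs \<mu> "d * h n" "b * h n" l "real n * (e * h n)"]
        indep_vars_subset[OF ind, of "{1..n}"] \<mu> d h[of n] b(2)[of n] l elim(2) zz zz4
      by (auto simp: A_def P_def c_def y_def mult_ac)
    also have "\<dots> = 2 * real n * exp (y * (l * (l * b))) / (z * z - 2)"
      by (simp add: zz[symmetric] c_def y_def power2_eq_square mult_ac)
    also have "\<dots> \<le> 2 * real n * z / (z * z / 2)"
    proof (intro frac_le mult_left_mono)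
      have "l * (l * b) \<le> l * (e / 2)" using l lb by (intro mult_left_mono) auto
      then show "exp (y * (l * (l * b))) \<le> z"
        using y by (auto simp: z_def c_def)
    qed (use zz4 z in auto)
    also have "\<dots> = 4 * real n / z" using z by (simp add: field_simps)
    also have "\<dots> \<le> 4 * real n / real n ^ 4"
      using z elim(2) by (intro divide_left_mono) auto
    also have "\<dots> \<le> 4 * inverse (real n ^ 2)"
      using elim(2) by (simp add: field_simps power2_eq_square power4_eq_xxxx)
    finally show ?case .
  qed
  then have "summable (\<lambda>n. prob (A n))"
    by (intro summable_comparison_test_ev[OF _ summable_mult[OF inverse_power_summable[of 2]]])
      (auto elim!: eventually_mono)
  then have "AE \<omega> in M. \<forall>\<^sub>F n in sequentially. \<omega> \<in> space M - A n"
    using A by (intro borel_cantelli_AE1) (auto simp: less_top[symmetric])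
  then show ?thesis
    by eventually_elim (auto simp: A_def P_def not_le elim!: eventually_mono)
qed

end

section \<open>The estimator and its mean\<close>

text \<open>As a function of the sample point \<open>y\<close>, the summand \<open>K ((x - y) / h)\<close> has no more variation than
\<open>K\<close>, whatever \<open>x\<close> and \<open>h\<close> are. The reflection reverses the order of the partition points.\<close>
lemma variation_sums_reflect_scale:
  assumes "0 < h"
  shows "variation_sums (\<lambda>y. K ((x - y) / h)) UNIV \<subseteq> variation_sums K UNIV"
proof
  fix v assume "v \<in> variation_sums (\<lambda>y. K ((x - y) / h)) UNIV"
  then obtain n t where v: "v = (\<Sum>i<n. \<bar>K ((x - t (Suc i)) / h) - K ((x - t i) / h)\<bar>)" and t: "mono t"
    by (auto simp: variation_sums_def)
  define t' where "t' i = (x - t (n - i)) / h" for i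
  have "mono t'"
    using t assms by (auto simp: mono_def t'_def intro!: divide_right_mono)
  have "v = (\<Sum>i<n. \<bar>K ((x - t (Suc (n - Suc i))) / h) - K ((x - t (n - Suc i)) / h)\<bar>)"
    unfolding v by (rule sum.nat_diff_reindex[symmetric])
  also have "\<dots> = (\<Sum>i<n. \<bar>K (t' (Suc i)) - K (t' i)\<bar>)"
    by (intro sum.cong refl) (auto simp: t'_def Suc_diff_Suc)
  finally show "v \<in> variation_sums K UNIV"
    using \<open>mono t'\<close> unfolding variation_sums_def by blast
qed

lemma diff_le_variation_bound:
  assumes V: "\<And>v. v \<in> variation_sums g UNIV \<Longrightarrow> v \<le> V"
  shows "\<bar>g x - g y\<bar> \<le> V"
proof -
  define t where "t i = (if i = 0 then min x y else max x y)" for i :: nat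
  have "mono t" by (auto simp: mono_def t_def)
  then have "(\<Sum>i<1. \<bar>g (t (Suc i)) - g (t i)\<bar>) \<le> V"
    by (intro V) (unfold variation_sums_def, blast)
  then show ?thesis by (auto simp: t_def min_def max_def split: if_splits)
qed

lemma kernel_density_estimator_nonneg:
  assumes "kernel_density K" "0 < h"
  shows "0 \<le> kernel_density_estimator K h n X x"
  using assms unfolding kernel_density_estimator_def
  by (intro mult_nonneg_nonneg sum_nonneg) (auto simp: kernel_density_def)

lemma has_bochner_integral_kernel_estimator:
  assumes K: "kernel_density K" and n: "1 \<le> n" and h: "0 < h"
  shows "has_bochner_integral lborel (kernel_density_estimator K h n X) 1"
proof -
  have "has_bochner_integral lborel (\<lambda>x. K ((x - X i) / h)) h" for i
  proof -
    have "has_bochner_integral lborel K 1"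
      using K by (auto simp: kernel_density_def has_bochner_integral_iff)
    then have "has_bochner_integral lborel (\<lambda>x. K (- X i / h + (1 / h) * x)) (1 /\<^sub>R \<bar>1 / h\<bar>)"
      using h by (subst (asm) lborel_has_bochner_integral_real_affine_iff[of "1 / h" _ _ "- X i / h"]) auto
    then show ?thesis
      using h by (simp add: diff_divide_distrib)
  qed
  then have "has_bochner_integral lborel (\<lambda>x. 1 / (real n * h) * (\<Sum>i=1..n. K ((x - X i) / h)))
      (1 / (real n * h) * (\<Sum>i=1..n. h))"
    by (intro has_bochner_integral_mult_right has_bochner_integral_sum)
  then show ?thesis
    using n h by (simp add: kernel_density_estimator_def[abs_def])
qed

text \<open>The comparison of integrals through cell masses, applied in both directions to the empirical
measure \<open>\<nu>\<close> and the true distribution \<open>\<mu>\<close>, with \<open>g y = K ((x - y) / h)\<close> and mesh \<open>d h\<close>. Since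
\<open>\<integral>g = h\<close> and all mass errors are multiples of \<open>h\<close>, the division by \<open>h\<close> leaves a bound free of
\<open>h\<close>, \<open>n\<close> and \<open>x\<close>.\<close>
lemma kernel_estimator_close_to_mean:
  assumes \<mu>: "prob_space \<mu>" "sets \<mu> = sets borel"
    and K: "kernel_density K" "continuous_on UNIV K"
    and V: "\<And>v. v \<in> variation_sums K UNIV \<Longrightarrow> v \<le> V"
    and n: "1 \<le> n" and h: "0 < h" and d: "0 < d" and e: "0 \<le> e" and c: "0 \<le> c"
    and mass: "\<And>k. measure \<mu> (cell (d * h) k) \<le> c * h"
    and dev: "\<And>k. \<bar>(\<Sum>i=1..n. indicator (cell (d * h) k) (X i)) - real n * measure \<mu> (cell (d * h) k)\<bar>
      \<le> real n * (e * h)"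
  shows "\<bar>kernel_density_estimator K h n X x - (\<integral>y. K ((x - y) / h) \<partial>\<mu>) / h\<bar> \<le> e / d + (c + e) * V"
proof -
  interpret mu: prob_space \<mu> by fact
  define \<nu> where "\<nu> = distr (measure_pmf (pmf_of_set {1..n})) borel X"
  have sets: "sets \<nu> = sets borel" by (simp add: \<nu>_def)
  have ne: "{1..n} \<noteq> {}" using n by auto
  define g where "g y = K ((x - y) / h)" for y
  have gc: "continuous_on UNIV g"
    unfolding g_def using h by (intro continuous_on_compose2[OF K(2)] continuous_intros) auto
  have [measurable]: "g \<in> borel_measurable borel"
    by (rule borel_measurable_continuous_onI[OF gc])
  have gm: "g \<in> borel_measurable \<mu>"
    unfolding measurable_cong_sets[OF \<mu>(2) refl] by measurable
  have g0: "0 \<le> g y" for y using K(1) by (auto simp: g_def kernel_density_def)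
  have gV: "v \<le> V" if "v \<in> variation_sums g UNIV" for v
    using variation_sums_reflect_scale[OF h, of K x] that V unfolding g_def by blast
  have V0: "0 \<le> V" using diff_le_variation_bound[of K V 0 0] V by simp
  have w: "0 < d * h" using d h by simp
  have Kb: "has_bochner_integral lborel K 1"
    using K by (auto simp: kernel_density_def has_bochner_integral_iff)
  have gl: "(\<integral>\<^sup>+y. g y \<partial>lborel) = ennreal h"
  proof -
    have "has_bochner_integral lborel (\<lambda>y. K (x / h + (- 1 / h) * y)) (1 /\<^sub>R \<bar>- 1 / h\<bar>)"
      using h Kb by (subst (asm) lborel_has_bochner_integral_real_affine_iff[of "- 1 / h" _ _ "x / h"]) auto
    then have "has_bochner_integral lborel g h"
      using h unfolding g_def by (simp add: diff_divide_distrib)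
    then show ?thesis
      using g0 by (simp add: has_bochner_integral_iff nn_integral_eq_integral)
  qed
  have g\<mu>: "(\<integral>\<^sup>+y. g y \<partial>\<mu>) = ennreal (\<integral>y. g y \<partial>\<mu>)"
  proof (rule nn_integral_eq_integral)
    have "\<bar>g y\<bar> \<le> \<bar>g 0\<bar> + V" for y
      using diff_le_variation_bound[of g V y 0] gV by fastforce
    then show "integrable \<mu> g"
      using gm by (intro mu.integrable_const_bound[of _ "\<bar>g 0\<bar> + V"]) auto
  qed (use g0 in auto)
  have g\<nu>: "(\<integral>\<^sup>+y. g y \<partial>\<nu>) = ennreal (h * kernel_density_estimator K h n X x)"
  proof -
    have "(\<integral>\<^sup>+y. g y \<partial>\<nu>) = ennreal ((\<Sum>i=1..n. g (X i)) / real n)"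
      unfolding \<nu>_def using ne n g0
      by (simp add: nn_integral_distr nn_integral_pmf_of_set sum_ennreal sum_nonneg
          ennreal_of_nat_eq_real_of_nat divide_ennreal)
    also have "(\<Sum>i=1..n. g (X i)) / real n = h * kernel_density_estimator K h n X x"
      using h by (simp add: kernel_density_estimator_def g_def)
    finally show ?thesis .
  qed
  have \<nu>c: "emeasure \<nu> (cell (d * h) k) = ennreal ((\<Sum>i=1..n. indicator (cell (d * h) k) (X i)) / real n)" for k
  proof -
    have "emeasure \<nu> (cell (d * h) k) = (\<integral>\<^sup>+y. ennreal (indicator (cell (d * h) k) y) \<partial>\<nu>)"
      by (simp add: sets ennreal_indicator)
    also have "\<dots> = ennreal ((\<Sum>i=1..n. indicator (cell (d * h) k) (X i)) / real n)"
      unfolding \<nu>_def using ne n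
      by (simp add: nn_integral_distr nn_integral_pmf_of_set sum_ennreal sum_nonneg
          ennreal_of_nat_eq_real_of_nat divide_ennreal)
    finally show ?thesis .
  qed
  have close: "\<bar>(\<Sum>i=1..n. indicator (cell (d * h) k) (X i)) / real n - measure \<mu> (cell (d * h) k)\<bar> \<le> e * h" for k
  proof -
    have "real n * \<bar>(\<Sum>i=1..n. indicator (cell (d * h) k) (X i)) / real n - measure \<mu> (cell (d * h) k)\<bar>
      = \<bar>real n * ((\<Sum>i=1..n. indicator (cell (d * h) k) (X i)) / real n - measure \<mu> (cell (d * h) k))\<bar>"
      by (simp add: abs_mult)
    also have "\<dots> \<le> real n * (e * h)"
      using dev[of k] n by (simp add: right_diff_distrib)
    finally show ?thesis using n by simp
  qed
  have err: "ennreal (e * h / (d * h)) * ennreal h = ennreal (e / d * h)"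
    using h e d by (simp add: ennreal_mult[symmetric])
  have pos: "0 \<le> (c + e) * h" using c e h by simp
  have K0: "0 \<le> h * kernel_density_estimator K h n X x"
    using kernel_density_estimator_nonneg[OF K(1) h] h by simp
  have I0: "0 \<le> (\<integral>y. g y \<partial>\<mu>)" using g0 by simp
  have edh: "0 \<le> e / d * h" "0 \<le> (c + e) * h * V" "0 \<le> e * h" using e d h c V0 by simp_all
  have "(\<integral>\<^sup>+y. g y \<partial>\<nu>) \<le> (\<integral>\<^sup>+y. g y \<partial>\<mu>) + ennreal (e * h / (d * h)) * (\<integral>\<^sup>+y. g y \<partial>lborel)
      + ennreal ((c + e) * h * V)"
  proof (rule nn_integral_le_if_cell_masses_le[OF w gc g0 gV \<mu>(2) sets edh(3) _ pos])
    fix k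
    show "emeasure \<nu> (cell (d * h) k) \<le> emeasure \<mu> (cell (d * h) k) + ennreal (e * h)"
      unfolding \<nu>c mu.emeasure_eq_measure using close[of k] edh
      by (auto simp del: ennreal_plus simp: ennreal_plus[symmetric] intro!: ennreal_leI)
    show "emeasure \<nu> (cell (d * h) k) \<le> ennreal ((c + e) * h)"
      unfolding \<nu>c using close[of k] mass[of k]
      by (intro ennreal_leI) (simp add: distrib_right)
  qed
  then have 1: "h * kernel_density_estimator K h n X x \<le> (\<integral>y. g y \<partial>\<mu>) + e / d * h + (c + e) * h * V"
    unfolding gl g\<mu> g\<nu> err using I0 edh K0 by (simp del: ennreal_plus add: ennreal_plus[symmetric])
  have "(\<integral>\<^sup>+y. g y \<partial>\<mu>) \<le> (\<integral>\<^sup>+y. g y \<partial>\<nu>) + ennreal (e * h / (d * h)) * (\<integral>\<^sup>+y. g y \<partial>lborel)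
      + ennreal ((c + e) * h * V)"
  proof (rule nn_integral_le_if_cell_masses_le[OF w gc g0 gV sets \<mu>(2) edh(3) _ pos])
    fix k
    show "emeasure \<mu> (cell (d * h) k) \<le> emeasure \<nu> (cell (d * h) k) + ennreal (e * h)"
      unfolding \<nu>c mu.emeasure_eq_measure using close[of k] edh
      by (auto simp del: ennreal_plus simp: ennreal_plus[symmetric] sum_nonneg intro!: ennreal_leI)
    show "emeasure \<mu> (cell (d * h) k) \<le> ennreal ((c + e) * h)"
      unfolding mu.emeasure_eq_measure using mass[of k] edh
      by (intro ennreal_leI) (simp add: distrib_right)
  qed
  then have 2: "(\<integral>y. g y \<partial>\<mu>) \<le> h * kernel_density_estimator K h n X x + e / d * h + (c + e) * h * V"
    unfolding gl g\<mu> g\<nu> err using I0 edh K0 by (simp del: ennreal_plus add: ennreal_plus[symmetric])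
  have "h * \<bar>kernel_density_estimator K h n X x - (\<integral>y. g y \<partial>\<mu>) / h\<bar>
      = \<bar>h * (kernel_density_estimator K h n X x - (\<integral>y. g y \<partial>\<mu>) / h)\<bar>"
    using h by (simp add: abs_mult)
  also have "h * (kernel_density_estimator K h n X x - (\<integral>y. g y \<partial>\<mu>) / h)
      = h * kernel_density_estimator K h n X x - (\<integral>y. g y \<partial>\<mu>)"
    using h by (simp add: right_diff_distrib)
  also have "\<bar>\<dots>\<bar> \<le> h * (e / d + (c + e) * V)"
    using 1 2 by (simp add: abs_le_iff algebra_simps)
  finally show ?thesis
    using h unfolding g_def by simp
qed

text \<open>A large value at one point forces large values on an interval of fixed length \<open>r\<close>, and with it a large
integral.\<close>
lemma uniformly_continuous_density_bounded:
  fixes f :: "real \<Rightarrow> real"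
  assumes f: "uniformly_continuous_on UNIV f" "\<And>x. 0 \<le> f x" "integrable lborel f"
  shows "\<exists>B>0. \<forall>x. f x \<le> B"
proof -
  obtain r where r: "0 < r" "\<And>x y. dist x y < r \<Longrightarrow> dist (f x) (f y) < 1"
    using f(1) unfolding uniformly_continuous_on_def by (metis UNIV_I zero_less_one)
  define J where "J = (\<integral>y. f y \<partial>lborel)"
  have J0: "0 \<le> J" using f(2) by (simp add: J_def)
  have "f x \<le> 1 + J / r" for x
  proof -
    have "r * (f x - 1) = (\<integral>y. indicator {x..<x + r} y * (f x - 1) \<partial>lborel)"
      using r(1) by simp
    also have "\<dots> \<le> J"
      unfolding J_def
    proof (intro integral_mono f(3))
      show "integrable lborel (\<lambda>y. indicator {x..<x + r} y * (f x - 1))"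
        using r(1) by (intro integrable_mult_left) (auto simp: integrable_indicator_iff)
      fix y
      show "indicator {x..<x + r} y * (f x - 1) \<le> f y"
        using r(2)[of x y] f(2)[of y] by (auto simp: indicator_def dist_real_def)
    qed
    finally show ?thesis using r(1) by (simp add: field_simps)
  qed
  then show ?thesis
    using J0 r(1) by (intro exI[of _ "1 + J / r"]) (auto intro: add_pos_nonneg)
qed

text \<open>The mean is \<open>\<integral>K(u) f(x - h u) du\<close>. Where \<open>h \<bar>u\<bar> < r\<close>, uniform continuity makes
\<open>f(x - h u)\<close> close to \<open>f(x)\<close>; the kernel mass of the remaining \<open>u\<close> vanishes as \<open>h \<longrightarrow> 0\<close>, by
dominated convergence.\<close>
lemma uniform_limit_convolution_kernel:
  fixes f K :: "real \<Rightarrow> real" and h :: "nat \<Rightarrow> real"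
  assumes K: "kernel_density K" and f: "uniformly_continuous_on UNIV f" "\<And>x. 0 \<le> f x" "\<And>x. f x \<le> B"
    and h: "\<And>n. 1 \<le> n \<Longrightarrow> 0 < h n" "h \<longlonglongrightarrow> 0"
  shows "uniform_limit UNIV (\<lambda>n x. (\<integral>y. K ((x - y) / h n) * f y \<partial>lborel) / h n) f sequentially"
proof (rule uniform_limitI)
  fix e :: real assume e: "0 < e"
  have Ki: "integrable lborel K" and K1: "(\<integral>u. K u \<partial>lborel) = 1" and K0: "\<And>u. 0 \<le> K u"
    using K by (auto simp: kernel_density_def)
  have [measurable]: "K \<in> borel_measurable borel" using Ki by auto
  have [measurable]: "f \<in> borel_measurable borel"
    using f(1) by (intro borel_measurable_continuous_onI uniformly_continuous_imp_continuous)
  obtain r where r: "0 < r" "\<And>x y. dist x y < r \<Longrightarrow> dist (f x) (f y) < e / 2"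
    using f(1) e unfolding uniformly_continuous_on_def by (metis UNIV_I half_gt_zero)
  have B0: "0 \<le> B" using f(2,3)[of 0] by simp
  define T where "T n = (\<integral>u. K u * indicator {u. r \<le> h n * \<bar>u\<bar>} u \<partial>lborel)" for n
  have "T \<longlonglongrightarrow> (\<integral>u. 0 \<partial>(lborel :: real measure))"
    unfolding T_def
  proof (rule integral_dominated_convergence[where w = K])
    show "AE u in lborel. (\<lambda>n. K u * indicator {u. r \<le> h n * \<bar>u\<bar>} u) \<longlonglongrightarrow> 0"
    proof (intro AE_I2 tendsto_eventually)
      fix u :: real
      have "(\<lambda>n. h n * \<bar>u\<bar>) \<longlonglongrightarrow> 0" using h(2) by (auto intro: tendsto_eq_intros)
      then have "\<forall>\<^sub>F n in sequentially. h n * \<bar>u\<bar> < r" using r(1) by (rule order_tendstoD)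
      then show "\<forall>\<^sub>F n in sequentially. K u * indicator {u. r \<le> h n * \<bar>u\<bar>} u = 0"
        by eventually_elim auto
    qed
  qed (use Ki K0 in \<open>auto simp: indicator_def\<close>)
  then have "(\<lambda>n. B * T n) \<longlonglongrightarrow> 0" by (auto intro: tendsto_eq_intros)
  then have "\<forall>\<^sub>F n in sequentially. B * T n < e / 2" using e by (intro order_tendstoD) auto
  then show "\<forall>\<^sub>F n in sequentially. \<forall>x\<in>UNIV. dist ((\<integral>y. K ((x - y) / h n) * f y \<partial>lborel) / h n) (f x) < e"
    using eventually_ge_at_top[of 1]
  proof eventually_elim
    case (elim n)
    have hn: "0 < h n" using h elim by simp
    have KTi: "integrable lborel (\<lambda>u. K u * indicator {u. r \<le> h n * \<bar>u\<bar>} u)"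
      using Ki by (rule Bochner_Integration.integrable_bound) (auto simp: indicator_def)
    show ?case
    proof
      fix x
      have i: "integrable lborel (\<lambda>u. K u * f (x - h n * u))"
        using f(2,3) K0 B0 by (intro Bochner_Integration.integrable_bound[OF integrable_mult_left[OF Ki, of B]])
          (auto intro!: AE_I2 mult_left_mono simp: abs_mult)
      have "(\<integral>y. K ((x - y) / h n) * f y \<partial>lborel) = h n * (\<integral>u. K u * f (x - h n * u) \<partial>lborel)"
        using hn by (subst lborel_integral_real_affine[where c = "- h n" and t = x]) auto
      then have "(\<integral>y. K ((x - y) / h n) * f y \<partial>lborel) / h n - f x
          = (\<integral>u. K u * f (x - h n * u) \<partial>lborel) - (\<integral>u. K u * f x \<partial>lborel)"
        using hn K1 by simp
      also have "\<dots> = (\<integral>u. K u * (f (x - h n * u) - f x) \<partial>lborel)"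
        using i Ki by (simp add: right_diff_distrib)
      finally have "\<bar>(\<integral>y. K ((x - y) / h n) * f y \<partial>lborel) / h n - f x\<bar>
          \<le> (\<integral>u. \<bar>K u * (f (x - h n * u) - f x)\<bar> \<partial>lborel)"
        by simp
      also have "\<dots> \<le> (\<integral>u. K u * (e / 2) + B * (K u * indicator {u. r \<le> h n * \<bar>u\<bar>} u) \<partial>lborel)"
      proof (rule integral_mono)
        show "integrable lborel (\<lambda>u. \<bar>K u * (f (x - h n * u) - f x)\<bar>)"
          using i Ki by (auto simp: right_diff_distrib)
        show "integrable lborel (\<lambda>u. K u * (e / 2) + B * (K u * indicator {u. r \<le> h n * \<bar>u\<bar>} u))"
          using Ki KTi by auto
        fix u
        have "\<bar>f (x - h n * u) - f x\<bar> \<le> e / 2 + B * indicator {u. r \<le> h n * \<bar>u\<bar>} u"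
        proof (cases "r \<le> h n * \<bar>u\<bar>")
          case True
          then show ?thesis
            using f(2,3)[of x] f(2,3)[of "x - h n * u"] e by (auto simp: abs_le_iff)
        next
          case False
          then show ?thesis
            using r(2)[of "x - h n * u" x] hn by (auto simp: dist_real_def abs_mult)
        qed
        then have "K u * \<bar>f (x - h n * u) - f x\<bar> \<le> K u * (e / 2 + B * indicator {u. r \<le> h n * \<bar>u\<bar>} u)"
          using K0 by (rule mult_left_mono)
        also have "K u * \<bar>f (x - h n * u) - f x\<bar> = \<bar>K u * (f (x - h n * u) - f x)\<bar>"
          using K0[of u] by (simp add: abs_mult)
        finally show "\<bar>K u * (f (x - h n * u) - f x)\<bar> \<le> K u * (e / 2) + B * (K u * indicator {u. r \<le> h n * \<bar>u\<bar>} u)"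
          by (simp add: algebra_simps)
      qed
      also have "\<dots> = e / 2 + B * T n"
        using Ki KTi K1 by (simp add: T_def)
      also have "\<dots> < e" using elim by simp
      finally show "dist ((\<integral>y. K ((x - y) / h n) * f y \<partial>lborel) / h n) (f x) < e"
        by (simp add: dist_real_def)
    qed
  qed
qed

text \<open>The fluctuation bound with mesh factor \<open>d\<close> and mass error \<open>d\<^sup>2 h\<^sub>n\<close> is \<open>d + (B d + d\<^sup>2) V\<close>.
Letting \<open>d\<close> run through \<open>1 / (j + 1)\<close> keeps the exceptional null sets countably many.\<close>
lemma AE_uniform_limit_kernel_density_estimator:
  fixes Xs :: "nat \<Rightarrow> 'a \<Rightarrow> real" and f K :: "real \<Rightarrow> real" and h :: "nat \<Rightarrow> real"
  assumes M: "prob_space M"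
    and ind: "prob_space.indep_vars M (\<lambda>_. borel) Xs {1..}"
    and dens: "\<And>i. 1 \<le> i \<Longrightarrow> distr M borel (Xs i) = density lborel f"
    and f: "uniformly_continuous_on UNIV f" "\<And>x. 0 \<le> f x" "\<And>x. f x \<le> B" and B: "0 < B"
    and K: "kernel_density K" "continuous_on UNIV K" "bounded_variation_on UNIV K"
    and h: "\<And>n. 1 \<le> n \<Longrightarrow> 0 < h n" "h \<longlonglongrightarrow> 0"
    and lim: "(\<lambda>n. inverse (real n * h n) * ln (real n)) \<longlonglongrightarrow> 0"
  shows "AE \<omega> in M. uniform_limit UNIV
    (\<lambda>n. kernel_density_estimator K (h n) n (\<lambda>i. Xs i \<omega>)) f sequentially"
proof -
  interpret prob_space M by fact
  define \<mu> where "\<mu> = density lborel f"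
  have "random_variable borel (Xs 1)"
    using ind by (auto simp: indep_vars_def)
  then have \<mu>: "prob_space \<mu>" "sets \<mu> = sets borel"
    using prob_space_distr[of "Xs 1" borel] dens[of 1] by (simp_all add: \<mu>_def)
  interpret mu: prob_space \<mu> by fact
  have [measurable]: "f \<in> borel_measurable borel"
    using f(1) by (intro borel_measurable_continuous_onI uniformly_continuous_imp_continuous)
  have [measurable]: "K \<in> borel_measurable borel"
    using K(2) by (rule borel_measurable_continuous_onI)
  obtain V where V: "\<And>v. v \<in> variation_sums K UNIV \<Longrightarrow> v \<le> V"
    using K(3) by (auto simp: bounded_variation_on_def bdd_above_def)
  have mass: "measure \<mu> (cell w k) \<le> B * w" if "0 < w" for w k
  proof -
    have "emeasure \<mu> (cell w k) = (\<integral>\<^sup>+x\<in>cell w k. f x \<partial>lborel)"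
      unfolding \<mu>_def by (subst emeasure_density) auto
    also have "\<dots> \<le> (\<integral>\<^sup>+x\<in>cell w k. ennreal B \<partial>lborel)"
      using f(3) by (intro nn_integral_mono) (auto simp: indicator_def ennreal_leI)
    also have "\<dots> = ennreal (B * w)"
      using B that by (simp add: nn_integral_cmult_indicator cell_def algebra_simps ennreal_mult[symmetric])
    finally show ?thesis
      using B that by (simp add: mu.emeasure_eq_measure ennreal_le_iff)
  qed
  define d where "d j = 1 / real (Suc j)" for j
  have d: "0 < d j" for j by (simp add: d_def)
  have d0: "d \<longlonglongrightarrow> 0"
    using LIMSEQ_inverse_real_of_nat unfolding d_def inverse_eq_divide .
  have "AE \<omega> in M. \<forall>j. \<forall>\<^sub>F n in sequentially. \<forall>k.
    \<bar>(\<Sum>i=1..n. indicator (cell (d j * h n) k) (Xs i \<omega>)) - real n * measure \<mu> (cell (d j * h n) k)\<bar>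
      < real n * ((d j)\<^sup>2 * h n)"
  proof (intro AE_all_countable[THEN iffD2] allI)
    fix j
    show "AE \<omega> in M. \<forall>\<^sub>F n in sequentially. \<forall>k.
      \<bar>(\<Sum>i=1..n. indicator (cell (d j * h n) k) (Xs i \<omega>)) - real n * measure \<mu> (cell (d j * h n) k)\<bar>
        < real n * ((d j)\<^sup>2 * h n)"
    proof (rule AE_cell_counts_concentrate[OF ind \<mu>(1) _ \<mu>(2) d h(1) _ _ lim])
      show "0 < B * d j" "0 < (d j)\<^sup>2" using B d[of j] by simp_all
      show "measure \<mu> (cell (d j * h n) k) \<le> B * d j * h n" if "1 \<le> n" for n k
        using mass[of "d j * h n" k] d[of j] h(1)[OF that] by (simp add: mult.assoc)
    qed (simp_all add: dens \<mu>_def)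
  qed
  then show ?thesis
  proof eventually_elim
    case (elim \<omega>)
    define m where "m n x = (\<integral>y. K ((x - y) / h n) * f y \<partial>lborel) / h n" for n x
    have m: "m n x = (\<integral>y. K ((x - y) / h n) \<partial>\<mu>) / h n" for n x
      unfolding m_def \<mu>_def using f(2) by (subst integral_real_density) (auto simp: mult.commute)
    have err: "(\<lambda>j. d j + (B * d j + (d j)\<^sup>2) * V) \<longlonglongrightarrow> 0"
      by (auto intro!: tendsto_eq_intros d0)
    show ?case
    proof (rule uniform_limitI)
      fix e :: real assume e: "0 < e"
      have "\<forall>\<^sub>F j in sequentially. d j + (B * d j + (d j)\<^sup>2) * V < e / 2"
        using e by (intro order_tendstoD(2)[OF err]) auto
      then obtain j where j: "d j + (B * d j + (d j)\<^sup>2) * V < e / 2"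
        by (auto simp: eventually_sequentially)
      have "\<forall>\<^sub>F n in sequentially. \<forall>x\<in>UNIV. dist (m n x) (f x) < e / 2"
        unfolding m_def using e
        by (intro uniform_limitD[OF uniform_limit_convolution_kernel[OF K(1) f h]]) auto
      with elim[rule_format, of j] eventually_ge_at_top[of 1]
      show "\<forall>\<^sub>F n in sequentially. \<forall>x\<in>UNIV.
        dist (kernel_density_estimator K (h n) n (\<lambda>i. Xs i \<omega>) x) (f x) < e"
      proof eventually_elim
        case (elim n)
        have hn: "0 < h n" using h elim by simp
        show ?case
        proof
          fix x
          have "\<bar>kernel_density_estimator K (h n) n (\<lambda>i. Xs i \<omega>) x - m n x\<bar>
            \<le> (d j)\<^sup>2 / d j + (B * d j + (d j)\<^sup>2) * V"
            unfolding m
          proof (rule kernel_estimator_close_to_mean[OF \<mu> K(1,2) V elim(2) hn d])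
            show "measure \<mu> (cell (d j * h n) k) \<le> B * d j * h n" for k
              using mass[of "d j * h n" k] d[of j] hn by (simp add: mult.assoc)
            show "\<bar>(\<Sum>i=1..n. indicator (cell (d j * h n) k) (Xs i \<omega>)) -
                real n * measure \<mu> (cell (d j * h n) k)\<bar> \<le> real n * ((d j)\<^sup>2 * h n)" for k
              using elim(1) by (simp add: less_imp_le)
          qed (use B d[of j] in auto)
          also have "(d j)\<^sup>2 / d j = d j"
            using d[of j] by (simp add: power2_eq_square)
          finally show "dist (kernel_density_estimator K (h n) n (\<lambda>i. Xs i \<omega>) x) (f x) < e"
            using dist_triangle[of "kernel_density_estimator K (h n) n (\<lambda>i. Xs i \<omega>) x" "f x" "m n x"]
              bspec[OF elim(3) UNIV_I, of x] j
            unfolding dist_real_def by linarith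
        qed
      qed
    qed
  qed
qed

section \<open>Integrals of powers of densities\<close>

text \<open>The factor \<open>a + b\<close> is what makes the bound integrable when \<open>a\<close> and \<open>b\<close> are values of two
densities.\<close>
lemma abs_diff_power_le:
  fixes a b C :: real
  assumes "0 \<le> a" "a \<le> C" "0 \<le> b" "b \<le> C"
  shows "\<bar>a ^ (m + 2) - b ^ (m + 2)\<bar> \<le> real (m + 1) * C ^ m * (\<bar>a - b\<bar> * (a + b))"
proof (induction m)
  case 0
  have "a\<^sup>2 - b\<^sup>2 = (a - b) * (a + b)" by (simp add: power2_eq_square algebra_simps)
  then have "\<bar>a\<^sup>2 - b\<^sup>2\<bar> = \<bar>a - b\<bar> * (a + b)" using assms by (simp add: abs_mult)
  then show ?case by (simp add: numeral_2_eq_2)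
next
  case (Suc m)
  have "a ^ (Suc m + 2) - b ^ (Suc m + 2) = a * (a ^ (m + 2) - b ^ (m + 2)) + b ^ (m + 2) * (a - b)"
    by (simp add: algebra_simps)
  then have "\<bar>a ^ (Suc m + 2) - b ^ (Suc m + 2)\<bar> \<le> a * \<bar>a ^ (m + 2) - b ^ (m + 2)\<bar> + b ^ (m + 2) * \<bar>a - b\<bar>"
    using assms by (metis abs_mult abs_of_nonneg abs_triangle_ineq zero_le_power)
  also have "a * \<bar>a ^ (m + 2) - b ^ (m + 2)\<bar> \<le> C * (real (m + 1) * C ^ m * (\<bar>a - b\<bar> * (a + b)))"
    using assms Suc by (intro mult_mono) auto
  also have "b ^ (m + 2) * \<bar>a - b\<bar> \<le> C ^ Suc m * (\<bar>a - b\<bar> * (a + b))"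
  proof -
    have "b ^ Suc m * (b * \<bar>a - b\<bar>) \<le> C ^ Suc m * ((a + b) * \<bar>a - b\<bar>)"
      using assms by (intro mult_mono power_mono) auto
    then show ?thesis by (simp add: mult_ac)
  qed
  finally show ?case by (simp add: algebra_simps)
qed

lemma integrable_bounded_power:
  fixes u :: "'a \<Rightarrow> real"
  assumes "integrable M u" "\<And>x. 0 \<le> u x" "\<And>x. u x \<le> C"
  shows "integrable M (\<lambda>x. u x ^ Suc k)"
proof (rule Bochner_Integration.integrable_bound[OF integrable_mult_right[OF assms(1), of "C ^ k"]])
  show "AE x in M. norm (u x ^ Suc k) \<le> norm (C ^ k * u x)"
  proof (rule AE_I2)
    fix x
    have "0 \<le> C" using assms(2,3)[of x] by linarith
    have "u x * u x ^ k \<le> u x * C ^ k"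
      using assms(2,3)[of x] by (intro mult_left_mono power_mono) auto
    then show "norm (u x ^ Suc k) \<le> norm (C ^ k * u x)"
      using assms(2)[of x] \<open>0 \<le> C\<close> by (simp add: mult.commute abs_mult)
  qed
qed (use assms(1) in auto)

lemma tendsto_integral_power_of_uniform_limit:
  fixes u :: "nat \<Rightarrow> 'a \<Rightarrow> real" and f :: "'a \<Rightarrow> real"
  assumes u: "\<forall>\<^sub>F n in sequentially. has_bochner_integral M (u n) 1 \<and> (\<forall>x. 0 \<le> u n x)"
    and f: "has_bochner_integral M f 1" "\<And>x. 0 \<le> f x" "\<And>x. f x \<le> B"
    and lim: "uniform_limit UNIV u f sequentially"
  shows "(\<lambda>n. \<integral>x. u n x ^ (m + 2) \<partial>M) \<longlonglongrightarrow> (\<integral>x. f x ^ (m + 2) \<partial>M)"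
proof (rule tendstoI)
  fix e :: real assume e: "0 < e"
  have B0: "0 \<le> B" using f(2,3)[of undefined] by linarith
  \<comment> \<open>Once \<open>u\<^sub>n\<close> is within 1 of \<open>f\<close>, both take values in \<open>[0, B + 1]\<close>, and \<open>L\<close> is the constant of
    \<open>abs_diff_power_le\<close> there; \<open>2 L s\<close> will bound the difference of the integrals.\<close>
  define L where "L = real (m + 1) * (B + 1) ^ m"
  have L: "0 < L" using B0 by (simp add: L_def)
  define s where "s = min 1 (e / (4 * L))"
  have s: "0 < s" "s \<le> 1" and sL: "2 * L * s < e"
    using e L by (auto simp: s_def min_def field_simps)
  have "\<forall>\<^sub>F n in sequentially. \<forall>x\<in>UNIV. dist (u n x) (f x) < s"
    using lim s(1) by (rule uniform_limitD)
  with u show "\<forall>\<^sub>F n in sequentially. dist (\<integral>x. u n x ^ (m + 2) \<partial>M) (\<integral>x. f x ^ (m + 2) \<partial>M) < e"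
  proof eventually_elim
    case (elim n)
    have un: "integrable M (u n)" "(\<integral>x. u n x \<partial>M) = 1" "\<And>x. 0 \<le> u n x"
      using elim by (auto simp: has_bochner_integral_iff)
    have fn: "integrable M f" "(\<integral>x. f x \<partial>M) = 1"
      using f by (auto simp: has_bochner_integral_iff)
    have close: "\<bar>u n x - f x\<bar> \<le> s" for x
      using elim by (auto simp: dist_real_def less_imp_le)
    have uC: "u n x \<le> B + 1" and fC: "f x \<le> B + 1" for x
      using close[of x] f(3)[of x] s(2) by auto
    have ui: "integrable M (\<lambda>x. u n x ^ (m + 2))" and fi: "integrable M (\<lambda>x. f x ^ (m + 2))"
      using integrable_bounded_power[OF un(1,3) uC, of "m + 1"]
        integrable_bounded_power[OF fn(1) f(2) fC, of "m + 1"] by simp_all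
    have "\<bar>(\<integral>x. u n x ^ (m + 2) \<partial>M) - (\<integral>x. f x ^ (m + 2) \<partial>M)\<bar>
        = \<bar>\<integral>x. u n x ^ (m + 2) - f x ^ (m + 2) \<partial>M\<bar>"
      using ui fi by simp
    also have "\<dots> \<le> (\<integral>x. \<bar>u n x ^ (m + 2) - f x ^ (m + 2)\<bar> \<partial>M)"
      by simp
    also have "\<dots> \<le> (\<integral>x. L * s * (u n x + f x) \<partial>M)"
    proof (rule integral_mono)
      fix x
      have "\<bar>u n x ^ (m + 2) - f x ^ (m + 2)\<bar> \<le> L * (\<bar>u n x - f x\<bar> * (u n x + f x))"
        unfolding L_def using un(3) f(2) uC fC by (intro abs_diff_power_le)
      also have "\<dots> \<le> L * (s * (u n x + f x))"
        using close[of x] L un(3)[of x] f(2)[of x] by (intro mult_left_mono mult_right_mono) auto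
      finally show "\<bar>u n x ^ (m + 2) - f x ^ (m + 2)\<bar> \<le> L * s * (u n x + f x)" by simp
    qed (use ui fi un fn in auto)
    also have "\<dots> = 2 * L * s"
      using un fn by simp
    finally show ?case
      using sL by (simp add: dist_real_def)
  qed
qed

text \<open>The expectation of \<open>f(X)\<^sup>k\<close> is the integral of \<open>f\<^sup>k\<^sup>+\<^sup>1\<close> over the whole line, the domain of
integration of the estimator.\<close>
lemma varextropy_eq_lborel:
  fixes X :: "'a \<Rightarrow> real" and f :: "real \<Rightarrow> real"
  assumes "prob_space M"
    and X: "distributed M lborel X (\<lambda>x. ennreal (f x))" and f0: "\<And>x. 0 \<le> f x"
    and [measurable]: "f \<in> borel_measurable borel"
    and i2: "integrable lborel (\<lambda>x. f x ^ 2)" and i3: "integrable lborel (\<lambda>x. f x ^ 3)"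
  shows "varextropy M X f = 1/4 * ((\<integral>x. f x ^ 3 \<partial>lborel) - (\<integral>x. f x ^ 2 \<partial>lborel) ^ 2)"
proof -
  interpret prob_space M by fact
  have E: "expectation (\<lambda>\<omega>. f (X \<omega>) ^ k) = (\<integral>x. f x ^ Suc k \<partial>lborel)" for k
    using distributed_integral[OF X, of "\<lambda>x. f x ^ k"] f0 by simp
  have I: "integrable M (\<lambda>\<omega>. f (X \<omega>) ^ k) \<longleftrightarrow> integrable lborel (\<lambda>x. f x ^ Suc k)" for k
    using distributed_integrable[OF X, of "\<lambda>x. f x ^ k"] f0 by simp
  have i: "integrable M (\<lambda>\<omega>. f (X \<omega>))" "integrable M (\<lambda>\<omega>. (f (X \<omega>))\<^sup>2)"
    using I[of 1] I[of 2] i2 i3 by (simp_all add: numeral_2_eq_2 numeral_3_eq_3)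
  have "varextropy M X f = expectation (\<lambda>\<omega>. (- (1/2) * f (X \<omega>))\<^sup>2)
      - (expectation (\<lambda>\<omega>. - (1/2) * f (X \<omega>)))\<^sup>2"
    unfolding varextropy_def using i by (intro variance_eq) (simp_all add: power_divide)
  also have "\<dots> = 1/4 * (expectation (\<lambda>\<omega>. f (X \<omega>) ^ 2) - (expectation (\<lambda>\<omega>. f (X \<omega>) ^ 1)) ^ 2)"
    by (simp add: power_divide field_simps)
  finally show ?thesis
    unfolding E by (simp add: numeral_2_eq_2 numeral_3_eq_3)
qed

theorem theorem2p2:
  fixes M :: "'a measure" and X :: "'a \<Rightarrow> real" and Xs :: "nat \<Rightarrow> 'a \<Rightarrow> real"
    and f K :: "real \<Rightarrow> real" and h :: "nat \<Rightarrow> real"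
  assumes "prob_space M"
    and "distributed M lborel X (\<lambda>x. ennreal (f x))" and "\<And>x. 0 \<le> f x"
    and "AE \<omega> in M. 0 \<le> X \<omega>"
    and "prob_space.indep_vars M (\<lambda>_. borel) Xs {1..}"
    and "\<And>i. 1 \<le> i \<Longrightarrow> distr M borel (Xs i) = distr M borel X"
    and "kernel_density K"
    and "uniformly_continuous_on UNIV K" and "bounded_variation_on UNIV K"
    and "(K \<longlongrightarrow> 0) at_top" and "(K \<longlongrightarrow> 0) at_bot"
    and "(\<integral>\<^sup>+x. ennreal (\<bar>x * ln \<bar>x\<bar>\<bar> powr (1/2)) \<partial>abs_stieltjes_measure K) < \<infinity>"
    and "uniformly_continuous_on UNIV f"
    and "\<And>n. 1 \<le> n \<Longrightarrow> 0 < h n"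
    and "h \<longlonglongrightarrow> 0"
    and "(\<lambda>n. inverse (real n * h n) * ln (real n)) \<longlonglongrightarrow> 0"
  shows "AE \<omega> in M. (\<lambda>n. VJD K (h n) n (\<lambda>i. Xs i \<omega>)) \<longlonglongrightarrow> varextropy M X f"
proof -
  interpret prob_space M by fact
  note X = assms(2) and f0 = assms(3) and K = assms(7) and fu = assms(13) and h = assms(14)
  have [measurable]: "f \<in> borel_measurable borel"
    using fu by (intro borel_measurable_continuous_onI uniformly_continuous_imp_continuous)
  have f1: "has_bochner_integral lborel f 1"
    using distributed_integral[OF X, of "\<lambda>_. 1"] distributed_integrable[OF X, of "\<lambda>_. 1"] f0
    by (simp add: has_bochner_integral_iff prob_space)
  then have fi: "integrable lborel f" by (simp add: has_bochner_integral_iff)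
  obtain B where B: "0 < B" "\<And>x. f x \<le> B"
    using uniformly_continuous_density_bounded[OF fu f0 fi] by blast
  have "distr M borel X = distr M lborel X"
    by (intro distr_cong) auto
  also have "\<dots> = density lborel f"
    by (rule distributed_distr_eq_density[OF X])
  finally have dens: "distr M borel (Xs i) = density lborel f" if "1 \<le> i" for i
    using assms(6)[OF that] by simp
  have "AE \<omega> in M. uniform_limit UNIV
      (\<lambda>n. kernel_density_estimator K (h n) n (\<lambda>i. Xs i \<omega>)) f sequentially"
    by (rule AE_uniform_limit_kernel_density_estimator[OF assms(1,5) dens fu f0 B(2,1) K
          uniformly_continuous_imp_continuous[OF assms(8)] assms(9) h assms(15,16)])
  then show ?thesis
  proof eventually_elim
    case (elim \<omega>)
    have "\<forall>\<^sub>F n in sequentially.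
        has_bochner_integral lborel (kernel_density_estimator K (h n) n (\<lambda>i. Xs i \<omega>)) 1 \<and>
        (\<forall>x. 0 \<le> kernel_density_estimator K (h n) n (\<lambda>i. Xs i \<omega>) x)"
      using eventually_ge_at_top[of 1]
    proof eventually_elim
      case (elim n)
      then show ?case
        using has_bochner_integral_kernel_estimator[OF K _ h] kernel_density_estimator_nonneg[OF K h] by blast
    qed
    note tendsto = tendsto_integral_power_of_uniform_limit[OF this f1 f0 B(2) elim]
    have "(\<lambda>n. VJD K (h n) n (\<lambda>i. Xs i \<omega>))
        \<longlonglongrightarrow> 1/4 * ((\<integral>x. f x ^ 3 \<partial>lborel) - (\<integral>x. f x ^ 2 \<partial>lborel) ^ 2)"
      unfolding VJD_def using tendsto[of 0] tendsto[of 1]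
      by (intro tendsto_intros) (simp_all add: numeral_2_eq_2 numeral_3_eq_3)
    also have "1/4 * ((\<integral>x. f x ^ 3 \<partial>lborel) - (\<integral>x. f x ^ 2 \<partial>lborel) ^ 2) = varextropy M X f"
      using integrable_bounded_power[OF fi f0 B(2), of 1] integrable_bounded_power[OF fi f0 B(2), of 2]
      by (intro varextropy_eq_lborel[OF assms(1) X f0, symmetric])
        (simp_all add: numeral_2_eq_2 numeral_3_eq_3)
    finally show ?case .
  qed
qed

end
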